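(* Let $\psi=[\psi_i]_{i=1}^m$ be a dictionary whose first observable is the constant function $\psi_1 = 1$, so that the data matrices have the form $$X=\begin{bmatrix}\mathbf{1}_n^H\\ X_2\end{bmatrix},\qquad Y=\begin{bmatrix}\mathbf{1}_n^H\\ Y_2\end{bmatrix},\qquad X_2,Y_2\in\mathbb{C}^{(m-1)\times n}.$$ Let $$E=E^{\oplus}=\begin{bmatrix}1\\ \mathbf{0}_{m-1}\end{bmatrix}\in\mathbb{C}^m,\qquad D=D^{\oplus}=\mathbf{0},$$ and consider the IC-DMD minimization $$\min_{A\in\mathcal{A}}\|AX-Y\|_F^2,\qquad \mathcal{A}:=\{A\in\mathbb{C}^{m\times m}: AD=D^{\oplus}\text{ and }E^HA=(E^{\oplus})^H\}.\qquad (\ast)$$ Let $(\widetilde{A},\widetilde{b})$ be the Affine DMD model parameters and $\mu_X,\mu_Y$ the sample means, as defined in the context. Then: 1. Every minimizer $A^*_{\rm IC}$ of $(\ast)$ has the same first row, namely it has the block form $$A^*_{\rm IC}=\begin{bmatrix}1 & 0\\ (A^*_{\rm IC})_{21} & (A^*_{\rm IC})_{22}\end{bmatrix},\qquad (A^*_{\rm IC})_{21}\in\mathbb{C}^{m-1},\ (A^*_{\rm IC})_{22}\in\mathbb{C}^{(m-1)\times(m-1)}.$$ 2. The matrix $$A^*_{\rm Affine}:=\begin{bmatrix}1 & 0\\ \widetilde{b} & \widetilde{A}\end{bmatrix}$$ is a solution (minimizer) of $(\ast)$. 3. Every minimizer $A^*_{\rm IC}$ of $(\ast)$ satisfies $$(A^*_{\rm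 IC})_{21}=\mu_Y-(A^*_{\rm IC})_{22}\,\mu_X .$$
   Context: Notation: $M^T$ is the transpose, $M^H$ the conjugate transpose, $\mathcal{R}(M)$ the column space, $\|\cdot\|_F$ the Frobenius norm; $\mathbf{1}_n$ is the all-ones column vector of length $n$ and $\mathbf{0}_k$ the zero column vector of length $k$. Setting: $\upsilon^+=\Gamma(\upsilon)$, $\upsilon\in\mathbb{R}^p$, is a discrete-time dynamical system with $\Gamma:\mathbb{R}^p\to\mathbb{R}^p$. The dictionary $\psi$ is a column vector of $m$ complex-valued functions on $\mathbb{R}^p$. For sample points $\upsilon_1,\dots,\upsilon_n$, the data matrices are $X=[\psi(\upsilon_j)]_{j=1}^n$ and $Y=[\psi(\Gamma(\upsilon_j))]_{j=1}^n$ in $\mathbb{C}^{m\times n}$. Sample means: $\mu_X:=X_2\frac{\mathbf{1}_n}{n}$ and $\mu_Y:=Y_2\frac{\mathbf{1}_n}{n}$. Affine DMD: the parameters $\widetilde{A}\in\mathbb{C}^{(m-1)\times(m-1)}$, $\widetilde{b}\in\mathbb{C}^{m-1}$ are defined as follows. - If $\mathcal{R}(Y_2^T)\subseteq\mathcal{R}(X^T)$: $(\widetilde{A},\widetilde{b})$ is a minimizer over $(A,b)$ of $\|A\|_F^2$ subject to $AX_2+b\mathbf{1}_n^H=Y_2$. - If $\mathcal{R}(Y_2^T)\nsubseteq\mathcal{R}(X^T)$: $(\widetilde{A},\widetilde{b})$ is a minimizer over $(A,b)$ of $\|AX_2+b\mathbf{1}_n^H-Y_2\|_F^2$. The choice $D=D^{\oplus}=\mathbf{0}$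 (zero matrices with $m$ rows) means that the constraint $AD=D^{\oplus}$ is vacuous. *)

theory Defs
  imports
    "Jordan_Normal_Form.Schur_Decomposition"
    "Jordan_Normal_Form.VS_Connect"
begin

text \<open>All indices are 0-based: the observables \<open>\<psi>\<^sub>1, \<dots>, \<psi>\<^sub>m\<close> are \<open>\<psi> 0, \<dots>, \<psi> (m - 1)\<close>, and
  the samples \<open>\<upsilon>\<^sub>1, \<dots>, \<upsilon>\<^sub>n\<close> are \<open>\<upsilon> 0, \<dots>, \<upsilon> (n - 1)\<close>.\<close>

definition data_matrix ::
  "nat \<Rightarrow> nat \<Rightarrow> (nat \<Rightarrow> real vec \<Rightarrow> complex) \<Rightarrow> (nat \<Rightarrow> real vec) \<Rightarrow> complex mat" where
  "data_matrix m n \<psi> \<upsilon> = mat m n (\<lambda>(i, j). \<psi> i (\<upsilon> j))"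

definition ones_vec :: "nat \<Rightarrow> complex vec" where
  "ones_vec n = vec n (\<lambda>_. 1)"

definition col_mat :: "complex vec \<Rightarrow> complex mat" where
  "col_mat v = mat_of_cols (dim_vec v) [v]"

definition lower_rows :: "complex mat \<Rightarrow> complex mat" where
  "lower_rows M = mat (dim_row M - 1) (dim_col M) (\<lambda>(i, j). M $$ (Suc i, j))"

lemma data_matrix_constant_first:
  assumes "1 \<le> m" and "\<And>j. j < n \<Longrightarrow> \<psi> 0 (\<upsilon> j) = 1"
  shows "data_matrix m n \<psi> \<upsilon> =
    mat_adjoint (col_mat (ones_vec n)) @\<^sub>r lower_rows (data_matrix m n \<psi> \<upsilon>)"
  using assms
  by (intro eq_matI)
    (auto simp: data_matrix_def lower_rows_def col_mat_def ones_vec_def mat_adjoint_def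
      append_rows_def mat_of_rows_def mat_of_cols_def cols_def)

definition frobenius_norm :: "complex mat \<Rightarrow> real" where
  "frobenius_norm M = sqrt (\<Sum>i<dim_row M. \<Sum>j<dim_col M. (cmod (M $$ (i, j)))\<^sup>2)"

definition sample_mean :: "complex mat \<Rightarrow> complex vec" where
  "sample_mean M = M *\<^sub>v ((1 / of_nat (dim_col M)) \<cdot>\<^sub>v ones_vec (dim_col M))"

text \<open>\<open>Dp\<close> and \<open>Ep\<close> stand for \<open>D\<^sup>\<oplus>\<close> and \<open>E\<^sup>\<oplus>\<close>.\<close>

definition ic_feasible ::
  "nat \<Rightarrow> complex mat \<Rightarrow> complex mat \<Rightarrow> complex mat \<Rightarrow> complex mat \<Rightarrow> complex mat set" where
  "ic_feasible m D Dp E Ep =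
    {A \<in> carrier_mat m m. A * D = Dp \<and> mat_adjoint E * A = mat_adjoint Ep}"

definition ic_dmd_minimizer ::
  "nat \<Rightarrow> complex mat \<Rightarrow> complex mat \<Rightarrow> complex mat \<Rightarrow> complex mat \<Rightarrow>
   complex mat \<Rightarrow> complex mat \<Rightarrow> complex mat \<Rightarrow> bool" where
  "ic_dmd_minimizer m D Dp E Ep X Y A \<longleftrightarrow>
    is_arg_min (\<lambda>A. (frobenius_norm (A * X - Y))\<^sup>2) (\<lambda>A. A \<in> ic_feasible m D Dp E Ep) A"

definition affine_model :: "complex mat \<Rightarrow> complex vec \<Rightarrow> complex mat \<Rightarrow> complex mat" where
  "affine_model A b X2 = A * X2 + col_mat b * mat_adjoint (col_mat (ones_vec (dim_col X2)))"

text \<open>The minimizer need not be unique (in the second case it is not when \<open>X\<close> is rank deficient), so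
  the affine DMD parameters are given by a predicate. In the first case only \<open>A\<close> is penalized, not \<open>b\<close>.\<close>

definition affine_dmd_params ::
  "nat \<Rightarrow> nat \<Rightarrow> complex mat \<Rightarrow> complex mat \<Rightarrow> complex mat \<Rightarrow> complex mat \<Rightarrow> complex vec \<Rightarrow> bool" where
  "affine_dmd_params m n X X2 Y2 A b \<longleftrightarrow>
    (if vec_space.col_space n (transpose_mat Y2) \<subseteq> vec_space.col_space n (transpose_mat X)
     then is_arg_min (\<lambda>(A, b). (frobenius_norm A)\<^sup>2)
            (\<lambda>(A, b). A \<in> carrier_mat (m - 1) (m - 1) \<and> b \<in> carrier_vec (m - 1) \<and>
               affine_model A b X2 = Y2) (A, b)
     else is_arg_min (\<lambda>(A, b). (frobenius_norm (affine_model A b X2 - Y2))\<^sup>2)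
            (\<lambda>(A, b). A \<in> carrier_mat (m - 1) (m - 1) \<and> b \<in> carrier_vec (m - 1)) (A, b))"

end

theory Submission
  imports Defs
begin

text \<open>The constraint on \<open>E\<close> says exactly that the first row of \<open>A\<close> is \<open>(1, 0)\<close>; for such an \<open>A\<close> the first
  row of \<open>A X - Y\<close> vanishes, so the IC-DMD objective is the unconstrained least-squares objective of the affine model.
  In the exactly solvable case of affine DMD this objective is \<open>0\<close>, whatever \<open>\<parallel>A\<parallel>\<close> is.
  For a fixed linear part, the variance decomposition shows that replacing \<open>b\<close> by \<open>\<mu>\<^sub>Y - A \<mu>\<^sub>X\<close>
  lowers the objective by \<open>n\<close> times the squared norm of the mean residual, so at a minimizer that mean is zero.\<close>

section \<open>Entries of block matrices with first row (1, 0)\<close>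

definition affine_block :: "complex vec \<Rightarrow> complex mat \<Rightarrow> complex mat" where
  "affine_block b A = four_block_mat (1\<^sub>m 1) (0\<^sub>m 1 (dim_col A)) (col_mat b) A"

lemma col_mat_carrier [simp]: "col_mat v \<in> carrier_mat (dim_vec v) 1"
  by (intro carrier_matI) (simp_all add: col_mat_def)

lemma dim_col_mat [simp]: "dim_row (col_mat v) = dim_vec v" "dim_col (col_mat v) = 1"
  by (simp_all add: col_mat_def)

lemma index_col_mat [simp]: "i < dim_vec v \<Longrightarrow> col_mat v $$ (i, 0) = v $ i"
  by (simp add: col_mat_def mat_of_cols_def)

lemma dim_ones_vec [simp]: "dim_vec (ones_vec n) = n"
  by (simp add: ones_vec_def)

lemma affine_block_carrier:
  "b \<in> carrier_vec l \<Longrightarrow> A \<in> carrier_mat l l \<Longrightarrow> affine_block b A \<in> carrier_mat (Suc l) (Suc l)"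
  by (auto simp: affine_block_def)

lemma index_affine_block:
  assumes "b \<in> carrier_vec l" "A \<in> carrier_mat l l"
  shows "affine_block b A $$ (0, 0) = 1"
    and "j < l \<Longrightarrow> affine_block b A $$ (0, Suc j) = 0"
    and "i < l \<Longrightarrow> affine_block b A $$ (Suc i, 0) = b $ i"
    and "i < l \<Longrightarrow> j < l \<Longrightarrow> affine_block b A $$ (Suc i, Suc j) = A $$ (i, j)"
  using assms by (auto simp: affine_block_def)

section \<open>The constraint on \<open>E\<close> as a condition on the first row\<close>

lemma index_mat_adjoint:
  "i < dim_col A \<Longrightarrow> j < dim_row A \<Longrightarrow> mat_adjoint A $$ (i, j) = conjugate (A $$ (j, i))"
  by (simp add: mat_adjoint_def mat_of_rows_def cols_def)

text \<open>Only entry \<open>r\<close> of the unit vector contributes to the product, and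
  conjugation leaves its entries 0 and 1 unchanged.\<close>

lemma index_adjoint_unit_vec_mult:
  assumes "A \<in> carrier_mat m c" "r < m" "j < c"
  shows "(mat_adjoint (col_mat (unit_vec m r)) * A) $$ (0, j) = A $$ (r, j)"
proof -
  have "(mat_adjoint (col_mat (unit_vec m r)) * A) $$ (0, j) =
      (\<Sum>i<m. (if i = r then 1 else 0) * A $$ (i, j))"
    using assms
    by (auto simp: scalar_prod_def index_mat_adjoint lessThan_atLeast0 mat_adjoint_def(1)
        intro!: sum.cong)
      (auto simp: mat_of_rows_def cols_def col_mat_def mat_of_cols_def)
  also have "\<dots> = A $$ (r, j)"
    using assms by (simp add: if_distrib [of "\<lambda>x. x * _"] cong: if_cong)
  finally show ?thesis .
qed

text \<open>Left multiplication by the adjoint of \<open>E\<close> reads off row 0, so the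
  constraint on \<open>E\<close> fixes that row and leaves all the others free. The zero matrices
  turn the other constraint into 0 = 0, whatever \<open>k\<close> is.\<close>

lemma ic_feasible_unit_vec:
  fixes l :: nat
  defines "E \<equiv> col_mat (unit_vec (Suc l) 0)"
  shows "ic_feasible (Suc l) (0\<^sub>m (Suc l) k) (0\<^sub>m (Suc l) k) E E =
    {affine_block b A | b A. b \<in> carrier_vec l \<and> A \<in> carrier_mat l l}" (is "?L = ?R")
proof (intro subset_antisym subsetI)
  fix A assume "A \<in> ?L"
  then have A: "A \<in> carrier_mat (Suc l) (Suc l)" and eq: "mat_adjoint E * A = mat_adjoint E"
    by (auto simp: ic_feasible_def)
  have row0: "A $$ (0, j) = (if j = 0 then 1 else 0)" if "j < Suc l" for j
  proof -
    have "A $$ (0, j) = (mat_adjoint E * A) $$ (0, j)"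
      unfolding E_def using A that by (intro index_adjoint_unit_vec_mult [symmetric]) auto
    then show ?thesis
      using that by (simp add: eq) (simp add: E_def index_mat_adjoint)
  qed
  define b where "b = vec l (\<lambda>i. A $$ (Suc i, 0))"
  define A' where "A' = mat l l (\<lambda>(i, j). A $$ (Suc i, Suc j))"
  have c: "b \<in> carrier_vec l" "A' \<in> carrier_mat l l"
    by (simp_all add: b_def A'_def)
  have "A = affine_block b A'"
  proof (rule eq_matI)
    fix i j assume "i < dim_row (affine_block b A')" "j < dim_col (affine_block b A')"
    then have "i < Suc l" "j < Suc l"
      using affine_block_carrier [OF c] by auto
    then show "A $$ (i, j) = affine_block b A' $$ (i, j)"
      by (cases i; cases j) (simp_all add: index_affine_block [OF c] row0, simp_all add: b_def A'_def)
  qed (use A affine_block_carrier [OF c] in auto)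
  with c show "A \<in> ?R" by blast
next
  fix M assume "M \<in> ?R"
  then obtain b A where M: "M = affine_block b A" and c: "b \<in> carrier_vec l" "A \<in> carrier_mat l l"
    by blast
  note Mc = affine_block_carrier [OF c, folded M]
  have dE: "mat_adjoint E \<in> carrier_mat 1 (Suc l)"
    by (intro carrier_matI) (simp_all add: E_def mat_adjoint_def(1))
  have "mat_adjoint E * M = mat_adjoint E"
  proof (rule eq_matI)
    fix i j assume "i < dim_row (mat_adjoint E)" "j < dim_col (mat_adjoint E)"
    then have ij: "i = 0" "j < Suc l"
      using dE by auto
    have "(mat_adjoint E * M) $$ (0, j) = M $$ (0, j)"
      unfolding E_def using Mc ij by (intro index_adjoint_unit_vec_mult) auto
    also have "\<dots> = mat_adjoint E $$ (0, j)"
      using ij by (cases j) (auto simp: M index_affine_block [OF c] E_def index_mat_adjoint)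
    finally show "(mat_adjoint E * M) $$ (i, j) = mat_adjoint E $$ (i, j)"
      by (simp add: ij)
  qed (use dE Mc in auto)
  then show "M \<in> ?L"
    using Mc by (auto simp: ic_feasible_def)
qed

section \<open>The affine model and the objective on block matrices\<close>

lemma affine_model_carrier:
  "X \<in> carrier_mat l n \<Longrightarrow> b \<in> carrier_vec l \<Longrightarrow> A \<in> carrier_mat l l \<Longrightarrow>
    affine_model A b X \<in> carrier_mat l n"
  by (auto simp: affine_model_def mat_adjoint_def)

lemma index_affine_model:
  assumes "X \<in> carrier_mat l n" "b \<in> carrier_vec l" "A \<in> carrier_mat l l" "i < l" "j < n"
  shows "affine_model A b X $$ (i, j) = (\<Sum>k<l. A $$ (i, k) * X $$ (k, j)) + b $ i"
proof -
  have "(col_mat b * mat_adjoint (col_mat (ones_vec n))) $$ (i, j) =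
      col_mat b $$ (i, 0) * mat_adjoint (col_mat (ones_vec n)) $$ (0, j)"
    using assms by (simp add: scalar_prod_def mat_adjoint_def(1))
  also have "\<dots> = b $ i"
    using assms by (simp add: index_mat_adjoint ones_vec_def)
  finally show ?thesis
    using assms by (auto simp: affine_model_def scalar_prod_def lessThan_atLeast0 mat_adjoint_def(1))
qed

text \<open>Row 0 of the block matrix reproduces the row of ones of \<open>X\<close>. In the lower
  rows, that row of ones multiplies column 0 of the block matrix and so contributes the offset
  \<open>b\<close> to every sample.\<close>

lemma affine_block_mult:
  assumes X: "X \<in> carrier_mat (Suc l) n" "\<And>j. j < n \<Longrightarrow> X $$ (0, j) = 1"
    and c: "b \<in> carrier_vec l" "A \<in> carrier_mat l l" and j: "j < n"
  shows "(affine_block b A * X) $$ (0, j) = 1"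
    and "i < l \<Longrightarrow> (affine_block b A * X) $$ (Suc i, j) = affine_model A b (lower_rows X) $$ (i, j)"
proof -
  note B = affine_block_carrier [OF c]
  \<comment> \<open>The term with index 0 of the inner sum is split off; its factor from
    \<open>X\<close> is 1.\<close>
  have prod: "(affine_block b A * X) $$ (i, j) =
      affine_block b A $$ (i, 0) + (\<Sum>k<l. affine_block b A $$ (i, Suc k) * X $$ (Suc k, j))"
    if "i < Suc l" for i
    using X B j that by (auto simp: scalar_prod_def sum.lessThan_Suc_shift
        simp flip: lessThan_atLeast0 simp del: sum.lessThan_Suc)
  show "(affine_block b A * X) $$ (0, j) = 1"
    by (simp add: prod index_affine_block [OF c])
  assume i: "i < l"
  have L: "lower_rows X \<in> carrier_mat l n"
    using X by (auto simp: lower_rows_def)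
  show "(affine_block b A * X) $$ (Suc i, j) = affine_model A b (lower_rows X) $$ (i, j)"
    using X i j by (simp add: prod index_affine_block [OF c] index_affine_model [OF L c])
      (simp add: lower_rows_def)
qed

lemma frobenius_norm_sq:
  "(frobenius_norm M)\<^sup>2 = (\<Sum>i<dim_row M. \<Sum>j<dim_col M. (cmod (M $$ (i, j)))\<^sup>2)"
  by (simp add: frobenius_norm_def sum_nonneg)

text \<open>Row 0 of the residual is 1 - 1 = 0 and adds nothing to the norm; row
  \<open>Suc i\<close> is row \<open>i\<close> of the affine residual.\<close>

lemma frobenius_norm_affine_block:
  assumes X: "X \<in> carrier_mat (Suc l) n" "\<And>j. j < n \<Longrightarrow> X $$ (0, j) = 1"
    and Y: "Y \<in> carrier_mat (Suc l) n" "\<And>j. j < n \<Longrightarrow> Y $$ (0, j) = 1"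
    and c: "b \<in> carrier_vec l" "A \<in> carrier_mat l l"
  shows "(frobenius_norm (affine_block b A * X - Y))\<^sup>2 =
    (frobenius_norm (affine_model A b (lower_rows X) - lower_rows Y))\<^sup>2"
proof -
  note B = affine_block_carrier [OF c]
  have L: "lower_rows X \<in> carrier_mat l n" "lower_rows Y \<in> carrier_mat l n"
    using X Y by (auto simp: lower_rows_def)
  note M = affine_model_carrier [OF L(1) c]
  have 0: "(affine_block b A * X - Y) $$ (0, j) = 0" if "j < n" for j
    using that X Y B affine_block_mult(1) [OF X c that] by (subst index_minus_mat) auto
  have S: "(affine_block b A * X - Y) $$ (Suc i, j) =
      (affine_model A b (lower_rows X) - lower_rows Y) $$ (i, j)" if "i < l" "j < n" for i j
    using that X Y B L M affine_block_mult(2) [OF X c that(2,1)]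
    by (subst (1 2) index_minus_mat) (auto simp: lower_rows_def)
  have d: "dim_row (affine_block b A * X - Y) = Suc l" "dim_col (affine_block b A * X - Y) = n"
    "dim_row (affine_model A b (lower_rows X) - lower_rows Y) = l"
    "dim_col (affine_model A b (lower_rows X) - lower_rows Y) = n"
    using X Y B L M by auto
  show ?thesis
    unfolding frobenius_norm_sq d sum.lessThan_Suc_shift
    by (simp add: 0 S del: index_minus_mat)
qed

section \<open>Variance decomposition and the optimal offset\<close>

lemma sum_cmod_sq_diff_mean:
  fixes r :: "nat \<Rightarrow> complex"
  assumes "(\<Sum>j<n. r j) = of_nat n * c"
  shows "(\<Sum>j<n. (cmod (r j - c))\<^sup>2) = (\<Sum>j<n. (cmod (r j))\<^sup>2) - n * (cmod c)\<^sup>2"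
proof -
  \<comment> \<open>Summing over \<open>j\<close> first gives \<open>n\<close> times
    \<open>c * cnj c\<close>. In the expanded square, twice this is subtracted while the constant
    term adds it once, which leaves the minus sign of the claim.\<close>
  have cross: "(\<Sum>j<n. Re (r j * cnj c)) = n * (cmod c)\<^sup>2"
  proof -
    have "(\<Sum>j<n. Re (r j * cnj c)) = Re ((\<Sum>j<n. r j) * cnj c)"
      by (simp only: sum_distrib_right Re_sum)
    also have "\<dots> = n * (cmod c)\<^sup>2"
      by (simp add: assms mult.assoc complex_norm_square [symmetric] flip: of_real_power)
    finally show ?thesis .
  qed
  have "(cmod (r j - c))\<^sup>2 = (cmod (r j))\<^sup>2 - 2 * Re (r j * cnj c) + (cmod c)\<^sup>2" for j
    by (simp add: cmod_power2) (simp add: power2_eq_square algebra_simps)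
  then have "(\<Sum>j<n. (cmod (r j - c))\<^sup>2) =
      (\<Sum>j<n. (cmod (r j))\<^sup>2) - 2 * (\<Sum>j<n. Re (r j * cnj c)) + n * (cmod c)\<^sup>2"
    by (simp add: sum.distrib sum_subtractf sum_distrib_left del: times_complex.simps)
  then show ?thesis
    by (simp add: cross del: times_complex.simps)
qed

lemma sample_mean_carrier: "M \<in> carrier_mat l n \<Longrightarrow> sample_mean M \<in> carrier_vec l"
  by (intro carrier_vecI) (auto simp: sample_mean_def)

lemma sum_row_eq_sample_mean:
  assumes "M \<in> carrier_mat l n" "i < l" "1 \<le> n"
  shows "(\<Sum>j<n. M $$ (i, j)) = of_nat n * sample_mean M $ i"
  using assms
  by (auto simp: sample_mean_def ones_vec_def scalar_prod_def lessThan_atLeast0 sum_distrib_left)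

text \<open>Averaging over the samples commutes with the affine map: the mean residual is
  \<open>A\<close> applied to the mean of \<open>X\<close>, plus \<open>b\<close>, minus the mean of
  \<open>Y\<close>.\<close>

lemma sum_row_affine_residual:
  assumes X: "X \<in> carrier_mat l n" and Y: "Y \<in> carrier_mat l n"
    and c: "b \<in> carrier_vec l" "A \<in> carrier_mat l l" and i: "i < l" and n: "1 \<le> n"
  shows "(\<Sum>j<n. (affine_model A b X - Y) $$ (i, j)) =
    of_nat n * (b - (sample_mean Y - A *\<^sub>v sample_mean X)) $ i"
proof -
  note M = affine_model_carrier [OF X c]
  note s = sample_mean_carrier [OF X] sample_mean_carrier [OF Y]
  have "(\<Sum>j<n. \<Sum>k<l. A $$ (i, k) * X $$ (k, j)) = (\<Sum>k<l. A $$ (i, k) * (\<Sum>j<n. X $$ (k, j)))"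
    by (subst sum.swap) (simp add: sum_distrib_left)
  also have "\<dots> = of_nat n * (\<Sum>k<l. A $$ (i, k) * sample_mean X $ k)"
    using n by (auto simp: sum_row_eq_sample_mean [OF X] sum_distrib_left intro!: sum.cong)
  also have "(\<Sum>k<l. A $$ (i, k) * sample_mean X $ k) = (A *\<^sub>v sample_mean X) $ i"
    using c i s by (auto simp: scalar_prod_def lessThan_atLeast0)
  finally have AX: "(\<Sum>j<n. \<Sum>k<l. A $$ (i, k) * X $$ (k, j)) = of_nat n * (A *\<^sub>v sample_mean X) $ i" .
  have "(\<Sum>j<n. (affine_model A b X - Y) $$ (i, j)) =
      (\<Sum>j<n. (\<Sum>k<l. A $$ (i, k) * X $$ (k, j)) + b $ i - Y $$ (i, j))"
    using X Y c i M by (intro sum.cong) (auto simp: index_affine_model [OF X c])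
  also have "\<dots> = of_nat n * (A *\<^sub>v sample_mean X) $ i + of_nat n * b $ i - of_nat n * sample_mean Y $ i"
    using i n by (simp add: sum.distrib sum_subtractf AX sum_row_eq_sample_mean [OF Y])
  also have "\<dots> = of_nat n * (b - (sample_mean Y - A *\<^sub>v sample_mean X)) $ i"
    using c i s by (simp add: algebra_simps del: index_mult_mat_vec)
  finally show ?thesis .
qed

text \<open>Passing from \<open>b\<close> to \<open>b'\<close> subtracts the constant
  \<open>(b - b') $ i\<close> from row \<open>i\<close> of the residual. This constant is exactly
  the mean of that row, so the variance decomposition applies row by row.\<close>

lemma frobenius_norm_affine_mean_offset:
  assumes X: "X \<in> carrier_mat l n" and Y: "Y \<in> carrier_mat l n"
    and c: "b \<in> carrier_vec l" "A \<in> carrier_mat l l" and n: "1 \<le> n"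
  defines "b' \<equiv> sample_mean Y - A *\<^sub>v sample_mean X"
  shows "(frobenius_norm (affine_model A b' X - Y))\<^sup>2 =
    (frobenius_norm (affine_model A b X - Y))\<^sup>2 - n * (\<Sum>i<l. (cmod ((b - b') $ i))\<^sup>2)"
proof -
  have b': "b' \<in> carrier_vec l"
    using c by (intro carrier_vecI) (auto simp: b'_def)
  note M = affine_model_carrier [OF X c] and M' = affine_model_carrier [OF X b' c(2)]
  have "(affine_model A b' X - Y) $$ (i, j) = (affine_model A b X - Y) $$ (i, j) - (b - b') $ i"
    if "i < l" "j < n" for i j
    using that X Y M M' c b'
    by (simp add: index_affine_model [OF X c] index_affine_model [OF X b' c(2)])
  then have "(\<Sum>j<n. (cmod ((affine_model A b' X - Y) $$ (i, j)))\<^sup>2) =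
      (\<Sum>j<n. (cmod ((affine_model A b X - Y) $$ (i, j)))\<^sup>2) - n * (cmod ((b - b') $ i))\<^sup>2"
    if "i < l" for i
    using that sum_row_affine_residual [OF X Y c that n, folded b'_def]
    by (subst sum_cmod_sq_diff_mean [symmetric]) auto
  moreover have "dim_row (affine_model A b X - Y) = l" "dim_col (affine_model A b X - Y) = n"
    "dim_row (affine_model A b' X - Y) = l" "dim_col (affine_model A b' X - Y) = n"
    using Y by auto
  ultimately show ?thesis
    unfolding frobenius_norm_sq by (simp add: sum_subtractf sum_distrib_left del: index_minus_mat index_minus_vec)
qed

text \<open>The linear part is fixed and only the offset competes. Comparison with the mean offset
  gives that \<open>n\<close> times a sum of squares is at most 0, and \<open>n\<close> is
  positive.\<close>

lemma frobenius_norm_affine_minimal_offset: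
  assumes X: "X \<in> carrier_mat l n" and Y: "Y \<in> carrier_mat l n"
    and c: "b \<in> carrier_vec l" "A \<in> carrier_mat l l" and n: "1 \<le> n"
    and min: "\<And>b'. b' \<in> carrier_vec l \<Longrightarrow>
      (frobenius_norm (affine_model A b X - Y))\<^sup>2 \<le> (frobenius_norm (affine_model A b' X - Y))\<^sup>2"
  shows "b = sample_mean Y - A *\<^sub>v sample_mean X"
proof -
  define b' where "b' = sample_mean Y - A *\<^sub>v sample_mean X"
  have b': "b' \<in> carrier_vec l"
    using c by (intro carrier_vecI) (auto simp: b'_def)
  have "real n * (\<Sum>i<l. (cmod ((b - b') $ i))\<^sup>2) \<le> 0"
    using min [OF b'] frobenius_norm_affine_mean_offset [OF X Y c n, folded b'_def] by linarith
  then have "(\<Sum>i<l. (cmod ((b - b') $ i))\<^sup>2) = 0"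
    using n by (intro antisym sum_nonneg) (auto simp: mult_le_0_iff)
  then have "\<forall>i<l. (b - b') $ i = 0"
    by (subst (asm) sum_nonneg_eq_0_iff) auto
  then have "b = b'"
    using c b' by (intro eq_vecI) auto
  then show ?thesis by (simp add: b'_def)
qed

text \<open>Both cases of the parameter definition lead to least-squares optimality: in the exactly
  solvable case the residual is the zero matrix, so the left side is 0; in the other case optimality
  is the definition itself.\<close>

lemma affine_dmd_params_least_squares:
  assumes "affine_dmd_params (Suc l) n X X2 Y2 A b" "Y2 \<in> carrier_mat l n"
  shows "b \<in> carrier_vec l" "A \<in> carrier_mat l l"
    and "b' \<in> carrier_vec l \<Longrightarrow> A' \<in> carrier_mat l l \<Longrightarrow>
      (frobenius_norm (affine_model A b X2 - Y2))\<^sup>2 \<le> (frobenius_norm (affine_model A' b' X2 - Y2))\<^sup>2"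
  using assms
  by (auto simp: affine_dmd_params_def is_arg_min_def not_less split: if_splits)
    (simp add: frobenius_norm_def sum_nonneg)

theorem proposition6p2:
  fixes m n p k :: nat
    and \<Gamma> :: "real vec \<Rightarrow> real vec"
    and \<psi> :: "nat \<Rightarrow> real vec \<Rightarrow> complex"
    and \<upsilon> :: "nat \<Rightarrow> real vec"
    and X Y X2 Y2 D Dp E Ep :: "complex mat"
    and \<mu>X \<mu>Y :: "complex vec"
  assumes "1 \<le> m" and "1 \<le> n"
    and "\<And>x. x \<in> carrier_vec p \<Longrightarrow> \<Gamma> x \<in> carrier_vec p"
    and "\<And>j. j < n \<Longrightarrow> \<upsilon> j \<in> carrier_vec p"
    and "\<And>x. x \<in> carrier_vec p \<Longrightarrow> \<psi> 0 x = 1"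
    and "X = data_matrix m n \<psi> \<upsilon>"
    and "Y = data_matrix m n \<psi> (\<lambda>j. \<Gamma> (\<upsilon> j))"
    and "X2 = lower_rows X" and "Y2 = lower_rows Y"
    and "\<mu>X = sample_mean X2" and "\<mu>Y = sample_mean Y2"
    and "E = col_mat (unit_vec m 0)" and "Ep = E"
    and "D = 0\<^sub>m m k" and "Dp = D"
  shows "(\<forall>A. ic_dmd_minimizer m D Dp E Ep X Y A \<longrightarrow>
            (\<exists>a21 \<in> carrier_vec (m - 1). \<exists>A22 \<in> carrier_mat (m - 1) (m - 1).
               A = four_block_mat (1\<^sub>m 1) (0\<^sub>m 1 (m - 1)) (col_mat a21) A22))
       \<and> (\<forall>At bt. affine_dmd_params m n X X2 Y2 At bt \<longrightarrow>
            ic_dmd_minimizer m D Dp E Ep X Y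
              (four_block_mat (1\<^sub>m 1) (0\<^sub>m 1 (m - 1)) (col_mat bt) At))
       \<and> (\<forall>A. \<forall>a21 \<in> carrier_vec (m - 1). \<forall>A22 \<in> carrier_mat (m - 1) (m - 1).
            ic_dmd_minimizer m D Dp E Ep X Y A \<longrightarrow>
            A = four_block_mat (1\<^sub>m 1) (0\<^sub>m 1 (m - 1)) (col_mat a21) A22 \<longrightarrow>
            a21 = \<mu>Y - A22 *\<^sub>v \<mu>X)"
proof -
  obtain l where m: "m = Suc l"
    using assms(1) by (cases m) auto
  \<comment> \<open>The first row of \<open>Y\<close> consists of ones because
    \<open>\<Gamma>\<close> keeps the samples in \<open>carrier_vec p\<close>, where
    \<open>\<psi> 0\<close> equals 1.\<close>
  have X: "X \<in> carrier_mat (Suc l) n" "\<And>j. j < n \<Longrightarrow> X $$ (0, j) = 1"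
    and Y: "Y \<in> carrier_mat (Suc l) n" "\<And>j. j < n \<Longrightarrow> Y $$ (0, j) = 1"
    using assms(3-7) by (auto simp: data_matrix_def m)
  have X2: "X2 \<in> carrier_mat l n" and Y2: "Y2 \<in> carrier_mat l n"
    using X Y assms(8,9) by (auto simp: lower_rows_def)
  \<comment> \<open>\<open>affine_block\<close> takes the width of its zero block from
    \<open>A\<close>, hence the condition on \<open>A\<close>.\<close>
  have block: "four_block_mat (1\<^sub>m 1) (0\<^sub>m 1 (m - 1)) (col_mat b) A = affine_block b A"
    if "A \<in> carrier_mat l l" for A b
    using that by (auto simp: affine_block_def m)
  have feas: "ic_feasible m D Dp E Ep =
      {affine_block b A | b A. b \<in> carrier_vec l \<and> A \<in> carrier_mat l l}"
    unfolding assms(12-15) m by (rule ic_feasible_unit_vec)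
  note obj = frobenius_norm_affine_block [OF X Y, folded assms(8,9)]
  \<comment> \<open>Feasible matrices are parametrized by pairs of offset and linear part, so the
    constrained problem becomes an unconstrained one over these pairs.\<close>
  have ic_iff: "ic_dmd_minimizer m D Dp E Ep X Y (affine_block b A) \<longleftrightarrow>
      (\<forall>b' A'. b' \<in> carrier_vec l \<longrightarrow> A' \<in> carrier_mat l l \<longrightarrow>
        (frobenius_norm (affine_model A b X2 - Y2))\<^sup>2 \<le> (frobenius_norm (affine_model A' b' X2 - Y2))\<^sup>2)"
    if "b \<in> carrier_vec l" "A \<in> carrier_mat l l" for b A
  proof -
    have mem: "affine_block b A \<in> ic_feasible m D Dp E Ep"
      using that feas by blast
    have "ic_dmd_minimizer m D Dp E Ep X Y (affine_block b A) \<longleftrightarrow>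
        (\<forall>M \<in> ic_feasible m D Dp E Ep.
          (frobenius_norm (affine_block b A * X - Y))\<^sup>2 \<le> (frobenius_norm (M * X - Y))\<^sup>2)"
      unfolding ic_dmd_minimizer_def is_arg_min_def not_less [symmetric] using mem by blast
    also have "\<dots> \<longleftrightarrow> (\<forall>b' A'. b' \<in> carrier_vec l \<longrightarrow> A' \<in> carrier_mat l l \<longrightarrow>
        (frobenius_norm (affine_block b A * X - Y))\<^sup>2 \<le> (frobenius_norm (affine_block b' A' * X - Y))\<^sup>2)"
      unfolding feas by blast
    finally show ?thesis
      by (simp add: obj that cong: imp_cong)
  qed
  show ?thesis
  proof (intro conjI allI impI ballI)
    fix A assume "ic_dmd_minimizer m D Dp E Ep X Y A"
    then have "A \<in> ic_feasible m D Dp E Ep"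
      by (simp add: ic_dmd_minimizer_def is_arg_min_def)
    then show "\<exists>a21 \<in> carrier_vec (m - 1). \<exists>A22 \<in> carrier_mat (m - 1) (m - 1).
        A = four_block_mat (1\<^sub>m 1) (0\<^sub>m 1 (m - 1)) (col_mat a21) A22"
      unfolding feas using block by (fastforce simp: m)
  next
    fix At bt assume "affine_dmd_params m n X X2 Y2 At bt"
    note ls = affine_dmd_params_least_squares [OF this [unfolded m] Y2]
    show "ic_dmd_minimizer m D Dp E Ep X Y
        (four_block_mat (1\<^sub>m 1) (0\<^sub>m 1 (m - 1)) (col_mat bt) At)"
      using ls by (simp only: block ic_iff) blast
  next
    fix A a21 A22
    assume "a21 \<in> carrier_vec (m - 1)" "A22 \<in> carrier_mat (m - 1) (m - 1)"
      and min: "ic_dmd_minimizer m D Dp E Ep X Y A"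
      and A: "A = four_block_mat (1\<^sub>m 1) (0\<^sub>m 1 (m - 1)) (col_mat a21) A22"
    then have c: "a21 \<in> carrier_vec l" "A22 \<in> carrier_mat l l"
      by (simp_all add: m)
    show "a21 = \<mu>Y - A22 *\<^sub>v \<mu>X"
      unfolding assms(10,11)
      \<comment> \<open>Optimality is used only against competitors with the same linear part
        \<open>A22\<close>.\<close>
      using min [unfolded A block [OF c(2)] ic_iff [OF c]] c assms(2) X2 Y2
      by (intro frobenius_norm_affine_minimal_offset [of X2 l n]) auto
  qed
qed

end
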